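(* Let $n\ge 2$ be even and let $A$ be a string of length $n$ over $\{\mathrm{H},\mathrm{T}\}$ all of whose characters are the same. Then Bob cannot force a loss for himself against Alice's string $A$: there is no string $B\neq A$ of length $n$ such that Alice wins the No-Flippancy game with Alice's string $A$ and Bob's string $B$.
   Context: No-Flippancy game: Alice and Bob have distinct strings $A=A_1\cdots A_n$ and $B=B_1\cdots B_n$ of the same length $n$ over the alphabet $\{\mathrm{H},\mathrm{T}\}$. Starting from the empty sequence, the players alternate turns, Alice going first, and on each turn the current player appends one letter to the sequence (the game output) as follows: let $i<n$ be the maximal length of a suffix of the current sequence that coincides with a prefix of the current player's string ($i=0$ is allowed, via the empty suffix); the player appends the letter with index $i+1$ of their own string. The game ends as soon as $A$ or $B$ appears as a block of consecutive letters in the sequence (necessarily as its suffix, no matter who made the last move); the player whose string appears first wins and the other loses. If neither string ever appears, the game is infinite (nobody wins). *)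

theory Defs
  imports "HOL-Library.Sublist"
begin

datatype letter = Heads | Tails

text \<open>For a string \<open>W\<close> of length \<open>n > 0\<close>, the set below is finite and contains \<open>0\<close>, so that the
  maximum is meaningful. Since lists are indexed from \<open>0\<close>, the letter number \<open>i + 1\<close> of \<open>W\<close> is
  \<open>W ! i\<close>.\<close>

definition overlap :: "letter list \<Rightarrow> letter list \<Rightarrow> nat" where
  "overlap W s = Max {i. i < length W \<and> suffix (take i W) s}"

definition next_letter :: "letter list \<Rightarrow> letter list \<Rightarrow> letter" where
  "next_letter W s = W ! overlap W s"

definition game_over :: "letter list \<Rightarrow> letter list \<Rightarrow> letter list \<Rightarrow> bool" where
  "game_over A B s \<longleftrightarrow> sublist A s \<or> sublist B s"

text \<open>The sequence after \<open>k\<close> turns, which stays constant once the game has ended. Turns are counted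
  from \<open>0\<close>, so Alice moves in the even turns.\<close>

fun game_seq :: "letter list \<Rightarrow> letter list \<Rightarrow> nat \<Rightarrow> letter list" where
  "game_seq A B 0 = []"
| "game_seq A B (Suc k) =
    (if game_over A B (game_seq A B k) then game_seq A B k
     else game_seq A B k @ [next_letter (if even k then A else B) (game_seq A B k)])"

definition alice_wins :: "letter list \<Rightarrow> letter list \<Rightarrow> bool" where
  "alice_wins A B \<longleftrightarrow>
    (\<exists>k. sublist A (game_seq A B k) \<and> (\<forall>j\<le>k. \<not> sublist B (game_seq A B j)))"

end

(* Alice always appends the letter c of A. Consider Bob's last move before Alice's win. If the win occurs
   on Bob's turn, he appends c to a run of n - 1 letters c; by maximality of the overlap his string then
   consists of letters c only, so B = A. Otherwise he appends c to a run of n - 2 letters c. If his overlap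
   is n - 1, this move completes B. If not, B consists of n - 1 letters c and a different letter; then the
   game starts with n - 1 letters c and, n being even, it is Bob who makes the n-th move and completes B. *)

theory Submission
  imports Defs
begin

lemma
  assumes "W \<noteq> []"
  shows overlap_less: "overlap W s < length W"
    and suffix_overlap: "suffix (take (overlap W s) W) s"
    and overlap_ge: "\<And>i. i < length W \<Longrightarrow> suffix (take i W) s \<Longrightarrow> i \<le> overlap W s"
proof -
  let ?S = "{i. i < length W \<and> suffix (take i W) s}"
  have fin: "finite ?S" by simp
  have "0 \<in> ?S" using assms by simp
  then have "overlap W s \<in> ?S"
    unfolding overlap_def using fin Max_in by blast
  then show "overlap W s < length W" "suffix (take (overlap W s) W) s" by auto
  show "i \<le> overlap W s" if "i < length W" "suffix (take i W) s" for i
    unfolding overlap_def using fin that by (intro Max_ge) auto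
qed

text \<open>A suffix no longer than the final run lies inside it, so its length determines it. This
  serves both to read off the prefix matched by an overlap and to exhibit a longer match.\<close>

lemma suffix_replicate_append:
  assumes "i \<le> m"
  shows "suffix xs (u @ replicate m c) \<and> length xs = i \<longleftrightarrow> xs = replicate i c"
proof -
  have eq: "u @ replicate m c = (u @ replicate (m - i) c) @ replicate i c"
    using assms by (simp flip: replicate_add)
  have "xs = replicate i c" if suf: "suffix xs (u @ replicate m c)" and len: "length xs = i"
  proof -
    obtain zs where "(u @ replicate (m - i) c) @ replicate i c = zs @ xs"
      using suf unfolding eq by (rule suffixE)
    then show ?thesis
      using len by (subst (asm) append_eq_append_conv) auto
  qed
  moreover have "suffix (replicate i c) (u @ replicate m c)"
    unfolding eq by (rule suffixI) (rule refl)
  ultimately show ?thesis by auto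
qed

text \<open>The whole sequence is already a matched prefix, and no suffix can be longer than the
  sequence.\<close>

lemma overlap_replicate:
  assumes "i < length W" and "take i W = replicate i c"
  shows "overlap W (replicate i c) = i"
proof (rule antisym)
  have "W \<noteq> []" using assms by auto
  then have "suffix (take (overlap W (replicate i c)) W) (replicate i c)"
    and "overlap W (replicate i c) < length W"
    by (simp_all add: suffix_overlap overlap_less)
  then show "overlap W (replicate i c) \<le> i"
    using suffix_length_le by fastforce
  show "i \<le> overlap W (replicate i c)"
    using \<open>W \<noteq> []\<close> assms by (intro overlap_ge) auto
qed

text \<open>An overlap short of \<open>m\<close> could be extended by the next letter \<open>c\<close>, so that it equals \<open>m\<close> unless
  \<open>W\<close> is exhausted.\<close>

lemma next_letter_eq_imp:
  assumes "W \<noteq> []" and "overlap W (u @ replicate m c) \<le> m"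
    and "next_letter W (u @ replicate m c) = c"
  shows "take (Suc m) W = replicate (min (Suc m) (length W)) c"
proof -
  let ?s = "u @ replicate m c"
  define i where "i = overlap W ?s"
  have i: "i < length W" "suffix (take i W) ?s" "i \<le> m"
    using assms by (auto simp: i_def overlap_less suffix_overlap)
  then have "take i W = replicate i c"
    using suffix_replicate_append[of i m "take i W" u c] by simp
  then have take: "take (Suc i) W = replicate (Suc i) c"
    using i assms(3)
    by (simp add: take_Suc_conv_app_nth next_letter_def i_def replicate_append_same)
  have "Suc i = length W \<or> i = m"
  proof (rule ccontr)
    assume "\<not> ?thesis"
    then have "Suc i < length W" "Suc i \<le> m" using i by auto
    moreover have "suffix (take (Suc i) W) ?s"
      using take suffix_replicate_append[OF \<open>Suc i \<le> m\<close>] by metis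
    ultimately have "Suc i \<le> overlap W ?s"
      using assms(1) by (intro overlap_ge) auto
    then show False by (simp add: i_def)
  qed
  then show ?thesis
  proof
    assume "Suc i = length W"
    moreover from this have "min (Suc m) (length W) = length W" using i(3) by simp
    ultimately show ?thesis using take i(3) by simp
  next
    assume "i = m"
    moreover from this have "min (Suc m) (length W) = Suc m" using i(1) by simp
    ultimately show ?thesis using take by simp
  qed
qed

lemma prefix_game_seq: "j \<le> k \<Longrightarrow> prefix (game_seq A B j) (game_seq A B k)"
  by (induction k rule: dec_induct) (auto simp: prefix_def)

lemma length_game_seq:
  assumes "\<And>j. j < k \<Longrightarrow> \<not> game_over A B (game_seq A B j)"
  shows "length (game_seq A B k) = k"
  using assms by (induction k) auto

lemma take_game_seq:
  assumes "\<And>j. j < k \<Longrightarrow> \<not> game_over A B (game_seq A B j)" and "j \<le> k"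
  shows "take j (game_seq A B k) = game_seq A B j"
proof -
  have "length (game_seq A B j) = j"
    using assms by (intro length_game_seq) auto
  then show ?thesis
    using prefix_game_seq[OF assms(2), of A B] by (auto simp: prefix_def)
qed

text \<open>While the sequence is a run shorter than \<open>n - 1\<close>, it is a prefix of both
  strings. So it is the full overlap for either player, and the next letter of either string is
  again \<open>c\<close>.\<close>

lemma game_seq_run:
  assumes "n > 0" and "length B = n" and "take (n - 1) B = replicate (n - 1) c" and "k < n"
    and "\<And>j. j < k \<Longrightarrow> \<not> game_over (replicate n c) B (game_seq (replicate n c) B j)"
  shows "game_seq (replicate n c) B k = replicate k c"
  using assms(4,5)
proof (induction k)
  case (Suc k)
  then have IH: "game_seq (replicate n c) B k = replicate k c" by simp
  have "take k B = replicate k c"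
    using arg_cong[OF assms(3), of "take k"] Suc.prems(1) by (simp add: min.absorb1)
  then have "overlap B (replicate k c) = k" "overlap (replicate n c) (replicate k c) = k"
    using Suc.prems assms(2) by (auto intro!: overlap_replicate)
  moreover have "B ! k = c"
    using arg_cong[OF assms(3), of "\<lambda>xs. xs ! k"] Suc.prems(1) by simp
  ultimately have "next_letter (if even k then replicate n c else B) (replicate k c) = c"
    using Suc.prems(1) by (simp add: next_letter_def)
  then show ?case
    using IH Suc.prems(2)[of k] by (simp add: replicate_append_same)
qed simp

theorem lemma11:
  fixes n :: nat and A :: "letter list"
  assumes "n \<ge> 2" and "even n" and "length A = n"
    and "\<forall>i<n. \<forall>j<n. A ! i = A ! j"
  shows "\<not> (\<exists>B. length B = n \<and> B \<noteq> A \<and> alice_wins A B)"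
proof
  assume "\<exists>B. length B = n \<and> B \<noteq> A \<and> alice_wins A B"
  then obtain B where B: "length B = n" "B \<noteq> A" "alice_wins A B" by blast
  define c where "c = A ! 0"
  have A: "A = replicate n c"
  proof (rule nth_equalityI)
    show "A ! i = replicate n c ! i" if "i < length A" for i
    proof -
      have "i < n" "0 < n" using that assms(3) by auto
      then show ?thesis using assms(4) unfolding c_def by (metis nth_replicate)
    qed
  qed (simp add: assms(3))
  have "B \<noteq> []" using B assms by auto
  let ?s = "game_seq A B"
  \<comment> \<open>The game sequence is constant after the end, so the least witness is taken:
    every turn before \<open>k\<close> then really appends a letter, and \<open>?s k\<close> has
    length \<open>k\<close>.\<close>
  define k where "k = (LEAST k. sublist A (?s k) \<and> (\<forall>j\<le>k. \<not> sublist B (?s j)))"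
  have k: "sublist A (?s k)" "\<And>j. j \<le> k \<Longrightarrow> \<not> sublist B (?s j)"
    using LeastI_ex[OF B(3)[unfolded alice_wins_def]] by (auto simp: k_def)
  have notA: "\<not> sublist A (?s j)" if "j < k" for j
    using not_less_Least[OF that[unfolded k_def]] k(2) that by fastforce
  have going: "\<not> game_over A B (?s j)" if "j < k" for j
    using notA k(2) that by (auto simp: game_over_def)
  have step: "?s (Suc j) = ?s j @ [next_letter (if even j then A else B) (?s j)]" if "j < k" for j
    using going[OF that] by simp
  have len: "length (?s j) = j" if "j \<le> k" for j
    using going that by (intro length_game_seq) auto
  have "n \<le> k"
    using sublist_length_le[OF k(1)] len[of k] assms(3) by simp
  obtain u v where uv: "?s k = u @ A @ v"
    using k(1) by (auto simp: sublist_def)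
  \<comment> \<open>With letters after \<open>A\<close>, the string \<open>A\<close> would have
    appeared a turn earlier.\<close>
  have "v = []"
  proof (rule ccontr)
    assume "v \<noteq> []"
    moreover have "take (k - 1) (?s k) = ?s (k - 1)"
      using going by (intro take_game_seq) auto
    ultimately have "?s (k - 1) = u @ A @ butlast v"
      using uv len[of k] by (metis butlast_append butlast_conv_take append_is_Nil_conv order_refl)
    then show False
      using notA[of "k - 1"] \<open>n \<le> k\<close> assms(1) by (auto simp: sublist_def)
  qed
  with uv A have sk: "?s k = u @ replicate n c" by simp
  with len[of k] have lenu: "length u = k - n" by simp
  \<comment> \<open>Undoing \<open>d\<close> turns only removes letters of the final copy of
    \<open>A\<close>.\<close>
  have run: "?s (k - d) = u @ replicate (n - d) c" if "d \<le> n" for d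
    using take_game_seq[of k A B "k - d"] going sk lenu that \<open>n \<le> k\<close> by simp
  have snoc: "u @ replicate (n - (d - 1)) c = u @ replicate (n - d) c @ [c]" if "0 < d" "d \<le> n" for d
  proof -
    have "n - (d - 1) = Suc (n - d)" using that by simp
    then show ?thesis by (metis replicate_Suc replicate_append_same)
  qed
  show False
  proof (cases "even k")
    case True
    \<comment> \<open>Turn \<open>k - 1\<close> is odd, so Bob completes \<open>A\<close>; the run
      of \<open>n - 1\<close> letters before it forces all \<open>n\<close> letters of
      \<open>B\<close> to be \<open>c\<close>.\<close>
    have "?s k = ?s (k - 1) @ [next_letter B (?s (k - 1))]"
      using step[of "k - 1"] True \<open>n \<le> k\<close> assms(1) by simp
    then have "next_letter B (u @ replicate (n - 1) c) = c"
      using run[of 1] sk snoc[of 1] assms(1) by simp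
    moreover have "overlap B (u @ replicate (n - 1) c) \<le> n - 1"
      using overlap_less[OF \<open>B \<noteq> []\<close>, of "u @ replicate (n - 1) c"] B(1) by simp
    ultimately show False
      using next_letter_eq_imp[OF \<open>B \<noteq> []\<close>, of u "n - 1" c] assms(1) A B by simp
  next
    case False
    let ?t = "u @ replicate (n - 2) c"
    \<comment> \<open>Parity excludes \<open>k = n\<close>, so the opening \<open>n\<close> moves
      are over before the winning one.\<close>
    have "n < k" using False assms(2) \<open>n \<le> k\<close> by (metis le_neq_implies_less)
    have "Suc (k - 2) = k - 1" "odd (k - 2)" using False \<open>n < k\<close> assms(1) by auto
    then have move: "?s (k - 1) = ?t @ [next_letter B ?t]"
      using step[of "k - 2"] run[of 2] \<open>n < k\<close> assms(1) by simp
    have "?s (k - 1) = ?t @ [c]"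
      using run[of 1] snoc[of 2] assms(1) by (simp add: numeral_2_eq_2)
    with move have next_c: "next_letter B ?t = c" by simp
    show False
    \<comment> \<open>An overlap of \<open>n - 1\<close> reaches beyond the run into
      \<open>u\<close>, so \<open>next_letter_eq_imp\<close> does not apply; but then Bob appends
      the last letter of \<open>B\<close>.\<close>
    proof (cases "overlap B ?t = n - 1")
      case True
      have "suffix (take (n - 1) B @ [B ! (n - 1)]) (?t @ [B ! (n - 1)])"
        using suffix_overlap[OF \<open>B \<noteq> []\<close>, of ?t] True by (auto simp: suffix_def)
      moreover have "take (n - 1) B @ [B ! (n - 1)] = B"
        using B(1) assms(1) take_Suc_conv_app_nth[of "n - 1" B] by simp
      ultimately have "suffix B (?s (k - 1))"
        using move True by (simp add: next_letter_def)
      then show False using k(2)[of "k - 1"] by auto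
    next
      case False
      have "Suc (n - 2) = n - 1" using assms(1) by simp
      have "overlap B ?t \<le> n - 2"
        using False overlap_less[OF \<open>B \<noteq> []\<close>, of ?t] B(1) by simp
      from next_letter_eq_imp[OF \<open>B \<noteq> []\<close> this next_c]
      have takeB: "take (n - 1) B = replicate (n - 1) c"
        unfolding \<open>Suc (n - 2) = n - 1\<close> by (simp add: B(1) min_def)
      then have start: "?s (n - 1) = take (n - 1) B"
        using game_seq_run[of n B c "n - 1"] going \<open>n < k\<close> B(1) assms(1) A by simp
      have "overlap B (take (n - 1) B) = n - 1"
        using overlap_replicate[of "n - 1" B c] takeB B(1) assms(1) by simp
      \<comment> \<open>Counted from 0, the n-th move is turn \<open>n - 1\<close>, which is odd
        because \<open>n\<close> is even; hence it is Bob's.\<close>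
      then have "?s n = take (n - 1) B @ [B ! (n - 1)]"
        using step[of "n - 1"] start \<open>n < k\<close> assms(1,2) by (simp add: next_letter_def)
      also have "\<dots> = B"
        using B(1) assms(1) take_Suc_conv_app_nth[of "n - 1" B] by simp
      finally show False using k(2)[of n] \<open>n < k\<close> by auto
    qed
  qed
qed

end
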